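(* Given a compact hypersurface $Z\subset\mathbb{R}^n$ of class $\mathcal{C}^1$ with reach $\rho(Z)>0$, there exists a $\mathcal{C}^1$ function $f:\mathbb{R}^n\to\mathbb{R}$ whose zero set is $Z$ and such that for every disk $D=D_R$ with $Z\subset\mathrm{int}\,D_{R-\rho(Z)}$ we have $$\kappa_1(f,D)\le2\left(1+\frac1{\rho(Z)}\right).$$
   Context: A compact hypersurface is a closed (compact, without boundary) submanifold of codimension $1$. The reach of $Z$ is $\rho(Z)=\sup\{r>0:\mathrm{dist}(x,Z)<r\Rightarrow\exists!\,z\in Z\text{ with }\mathrm{dist}(x,Z)=\mathrm{dist}(x,z)\}$. $D_R$ denotes a closed ball of radius $R$ in $\mathbb{R}^n$ and $D_{R-\rho(Z)}$ the concentric closed ball of radius $R-\rho(Z)$. For $f$ of class $\mathcal{C}^1$ on $D$ put $$\nu_1(f,D)=\sup_{x\in D}\left(|f(x)|^2+\|\nabla f(x)\|^2\right)^{1/2},\quad\delta(f,D)=\inf_{x\in D}\left(|f(x)|^2+\|\nabla f(x)\|^2\right)^{1/2},\quad m(f,D)=\min_{x\in\partial D}|f(x)|,$$ $$\kappa_1(f,D)=\frac{\nu_1(f,D)}{\min\{m(f,D),\delta(f,D)\}}.$$ *)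

theory Defs
  imports "HOL-Analysis.Analysis"
begin

definition C1_on :: "('a::euclidean_space \<Rightarrow> 'b::euclidean_space) \<Rightarrow> 'a set \<Rightarrow> bool" where
  "C1_on f U \<longleftrightarrow> open U \<and>
     (\<exists>f' :: 'a \<Rightarrow> ('a \<Rightarrow>\<^sub>L 'b).
        (\<forall>x\<in>U. (f has_derivative blinfun_apply (f' x)) (at x)) \<and> continuous_on U f')"

text \<open>An embedded submanifold of codimension 1 (without boundary), given by slice charts: near each
  of its points, a local diffeomorphism of the ambient space carries \<open>Z\<close> to a coordinate hyperplane.\<close>

definition C1_hypersurface :: "'a::euclidean_space set \<Rightarrow> bool" where
  "C1_hypersurface Z \<longleftrightarrow>
     (\<forall>p\<in>Z. \<exists>(U :: 'a set) (V :: 'a set) \<phi> \<psi>. \<exists>b\<in>Basis.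
        p \<in> U \<and> homeomorphism U V \<phi> \<psi> \<and> C1_on \<phi> U \<and> C1_on \<psi> V \<and>
        \<phi> ` (U \<inter> Z) = V \<inter> {y. y \<bullet> b = 0})"

definition compact_C1_hypersurface :: "'a::euclidean_space set \<Rightarrow> bool" where
  "compact_C1_hypersurface Z \<longleftrightarrow> compact Z \<and> C1_hypersurface Z"

text \<open>The reach can be infinite (a single point of the line), so it is an extended real.
  As \<^term>\<open>infdist x {} = 0\<close>, the empty set has reach \<^term>\<open>- \<infinity> :: ereal\<close>; thus positive reach
  includes \<^term>\<open>Z \<noteq> {}\<close>.\<close>

definition reach :: "'a::euclidean_space set \<Rightarrow> ereal" where
  "reach Z = Sup {ereal r | r. 0 < r \<and>
     (\<forall>x. infdist x Z < r \<longrightarrow> (\<exists>!z. z \<in> Z \<and> infdist x Z = dist x z))}"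

text \<open>A closed ball with extended radius; it is empty for negative radius, in particular for radius
  \<^term>\<open>ereal R - \<infinity>\<close>.\<close>

definition disk :: "'a::euclidean_space \<Rightarrow> ereal \<Rightarrow> 'a set" where
  "disk c r = {x. ereal (dist c x) \<le> r}"

definition gradient :: "('a::euclidean_space \<Rightarrow> real) \<Rightarrow> 'a \<Rightarrow> 'a" where
  "gradient f x = (THE D. GDERIV f x :> D)"

text \<open>The suprema and infima below are taken in the extended reals, and so is the quotient in
  \<open>kappa1\<close>: when its denominator vanishes and its numerator does not, it is \<open>\<infinity>\<close>,
  so that an upper bound on it does assert that the denominator is nonzero.\<close>

definition nu1 :: "('a::euclidean_space \<Rightarrow> real) \<Rightarrow> 'a set \<Rightarrow> ereal" where
  "nu1 f D = (SUP x\<in>D. ereal (sqrt (\<bar>f x\<bar>\<^sup>2 + (norm (gradient f x))\<^sup>2)))"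

definition delta :: "('a::euclidean_space \<Rightarrow> real) \<Rightarrow> 'a set \<Rightarrow> ereal" where
  "delta f D = (INF x\<in>D. ereal (sqrt (\<bar>f x\<bar>\<^sup>2 + (norm (gradient f x))\<^sup>2)))"

text \<open>For continuous \<open>f\<close> and a ball \<open>D\<close> of positive radius this infimum is attained, as the sphere is
  compact and nonempty.\<close>

definition bdry_min :: "('a::euclidean_space \<Rightarrow> real) \<Rightarrow> 'a set \<Rightarrow> ereal" where
  "bdry_min f D = (INF x\<in>frontier D. ereal \<bar>f x\<bar>)"

definition kappa1 :: "('a::euclidean_space \<Rightarrow> real) \<Rightarrow> 'a set \<Rightarrow> ereal" where
  "kappa1 f D = nu1 f D / min (bdry_min f D) (delta f D)"

end

theory Submission
  imports Defs
begin

text \<open>Let \<open>\<rho>\<close> be the reach of \<open>Z\<close> and \<open>r = \<rho> / (\<rho> + 1)\<close> (\<open>r = 1\<close> if \<open>\<rho> = \<infinity>\<close>), so that \<open>r < \<rho>\<close>, \<open>r \<le> 1\<close> and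
  \<open>2 / r = 2 * (1 + 1 / \<rho>)\<close>. The function \<open>f\<close> is the signed distance to \<open>Z\<close> composed with the odd \<open>C\<^sup>1\<close>
  function whose derivative is \<open>max 0 (1 - \<bar>t\<bar> / r)\<close>; it saturates at \<open>\<plusminus> r / 2\<close>, and \<open>f\<^sup>2 + \<bar>\<nabla>f\<bar>\<^sup>2\<close> stays between
  \<open>(r / 2)\<^sup>2\<close> and 1.

  Below the reach the nearest point projection is continuous, which makes the signed distance \<open>C\<^sup>1\<close>
  locally, up to sign. A coherent choice of signs is found by lifting a line field: the vector
  \<open>(\<tau>, (r - \<bar>\<tau>\<bar>) N)\<close> built from a local signed distance \<open>\<tau>\<close> and its gradient \<open>N\<close> is defined up to sign and
  becomes vertical at distance \<open>r\<close>, so it spans a line field on the whole space, which has a continuous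
  nonvanishing section; the first component of the section has the desired sign.\<close>

section \<open>Sections of line fields\<close>

lemma continuous_on_locally_openI:
  fixes f :: "'a::t2_space \<Rightarrow> 'b::topological_space"
  assumes "\<And>x. x \<in> S \<Longrightarrow> \<exists>U. open U \<and> x \<in> U \<and> continuous_on (S \<inter> U) f"
  shows "continuous_on S f"
  unfolding continuous_on_eq_continuous_within
proof
  fix x assume "x \<in> S"
  then obtain U where U: "open U" "x \<in> U" "continuous_on (S \<inter> U) f"
    using assms by blast
  then have "continuous (at x within S \<inter> U) f"
    using \<open>x \<in> S\<close> by (simp add: continuous_on_eq_continuous_within)
  moreover have "at x within S \<inter> U = at x within S"
    by (rule at_within_nhd[OF U(2,1)]) blast
  ultimately show "continuous (at x within S) f"
    by (simp add: continuous_within)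
qed

text \<open>Transport \<open>v 0\<close> along the radii by projecting it successively onto the lines at \<open>(k / N) x\<close>.\<close>

lemma line_field_section:
  fixes v :: "'a::euclidean_space \<Rightarrow> 'b::euclidean_space"
  assumes nz: "\<And>x. v x \<noteq> 0"
    and loc: "\<And>x. \<exists>U v'. open U \<and> x \<in> U \<and> continuous_on U v' \<and> (\<forall>y\<in>U. v' y = v y \<or> v' y = - v y)"
  shows "\<exists>w. continuous_on (cball 0 M) w \<and> (\<forall>x\<in>cball 0 M. \<exists>\<beta>. \<beta> \<noteq> 0 \<and> w x = \<beta> *\<^sub>R v x)"
proof -
  \<comment> \<open>On a good set no two lines are orthogonal, so projecting a nonzero vector of one
    line onto another never gives zero.\<close>
  define good where "good G \<longleftrightarrow> open G \<and> (\<forall>y\<in>G. \<forall>z\<in>G. v y \<bullet> v z \<noteq> 0)" for G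
  have "\<exists>G. x \<in> G \<and> good G" for x
  proof -
    obtain U v' where U: "open U" "x \<in> U" "continuous_on U v'"
      and v': "\<forall>y\<in>U. v' y = v y \<or> v' y = - v y" using loc by blast
    \<comment> \<open>Vectors within a third of \<open>norm (v' x)\<close> of \<open>v' x\<close>
      are longer than \<open>2 * r\<close>, while any two of them are less than \<open>2 * r\<close>
      apart; this forces a positive inner product.\<close>
    define r where "r = norm (v' x) / 3"
    have r: "r > 0" using v' U(2) nz[of x] by (auto simp: r_def)
    define G where "G = U \<inter> v' -` ball (v' x) r"
    have "open G" unfolding G_def by (rule continuous_open_preimage[OF U(3,1)]) simp
    moreover have "v y \<bullet> v z \<noteq> 0" if "y \<in> G" "z \<in> G" for y z
    proof -
      have d: "dist (v' x) (v' y) < r" "dist (v' x) (v' z) < r" using that by (auto simp: G_def)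
      have "norm (v' x) \<le> norm (v' y) + dist (v' x) (v' y)"
        using norm_triangle_ineq[of "v' y" "v' x - v' y"] by (simp add: dist_norm)
      moreover have "dist (v' y) (v' z) < 2 * r"
        using dist_triangle3[of "v' y" "v' z" "v' x"] d by linarith
      ultimately have "dist (v' y) (v' z) < norm (v' y)" using d r by (simp add: r_def)
      then have "(norm (v' y - v' z))\<^sup>2 < (norm (v' y))\<^sup>2"
        by (simp add: dist_norm power_strict_mono)
      then have "v' y \<bullet> v' z > 0"
        unfolding power2_norm_eq_inner using inner_ge_zero[of "v' z"]
        by (simp add: inner_diff_left inner_diff_right inner_commute del: inner_ge_zero)
      moreover have "y \<in> U" "z \<in> U" using that by (auto simp: G_def)
      ultimately show ?thesis using v'[rule_format, of y] v'[rule_format, of z] by auto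
    qed
    moreover have "x \<in> G" using U(2) r by (simp add: G_def)
    ultimately show ?thesis by (auto simp: good_def)
  qed
  then have "cball 0 M \<subseteq> \<Union>(Collect good)" by blast
  then obtain e where e: "e > 0" "\<And>x. x \<in> cball 0 M \<Longrightarrow> \<exists>G \<in> Collect good. ball x e \<subseteq> G"
    by (rule Heine_Borel_lemma[OF compact_cball]) (auto simp: good_def)
  \<comment> \<open>\<open>e\<close> is a Lebesgue number of the cover by good sets. Dividing each
    radius into \<open>N\<close> pieces makes consecutive points less than \<open>e\<close> apart,
    hence members of a common good set.\<close>
  obtain N :: nat where N: "\<bar>M\<bar> / e < N" using reals_Archimedean2 by blast
  then have N0: "N > 0" using e by (cases "N = 0") (auto simp: divide_less_0_iff)
  have "\<exists>w. continuous_on (cball 0 M) w \<and>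
      (\<forall>x\<in>cball 0 M. \<exists>\<beta>. \<beta> \<noteq> 0 \<and> w x = \<beta> *\<^sub>R v ((real k / N) *\<^sub>R x))" if "k \<le> N" for k
    using that
  proof (induction k)
    case 0
    then show ?case by (intro exI[of _ "\<lambda>_. v 0"]) (auto intro!: exI[of _ 1])
  next
    case (Suc k)
    then obtain w where w: "continuous_on (cball 0 M) w"
      "\<forall>x\<in>cball 0 M. \<exists>\<beta>. \<beta> \<noteq> 0 \<and> w x = \<beta> *\<^sub>R v ((real k / N) *\<^sub>R x)" by auto
    let ?p = "\<lambda>x. (real (Suc k) / N) *\<^sub>R x"
    \<comment> \<open>Up to a positive factor this projects \<open>w x\<close> onto the next line.
      The formula is even in \<open>v (?p x)\<close>, so the continuous local choice
      \<open>v'\<close> may replace \<open>v\<close>.\<close>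
    let ?w = "\<lambda>x. (v (?p x) \<bullet> w x) *\<^sub>R v (?p x)"
    have "continuous_on (cball 0 M) ?w"
    proof (rule continuous_on_locally_openI)
      fix x assume "x \<in> cball (0::'a) M"
      obtain U v' where U: "open U" "?p x \<in> U" "continuous_on U v'"
        and v': "\<forall>y\<in>U. v' y = v y \<or> v' y = - v y" using loc by blast
      have "continuous_on (cball 0 M \<inter> ?p -` U) (\<lambda>x. (v' (?p x) \<bullet> w x) *\<^sub>R v' (?p x))"
        by (intro continuous_intros continuous_on_compose2[OF U(3)] continuous_on_subset[OF w(1)]) auto
      then have "continuous_on (cball 0 M \<inter> ?p -` U) ?w"
      proof (rule continuous_on_eq)
        fix y assume "y \<in> cball 0 M \<inter> ?p -` U"
        then show "(v' (?p y) \<bullet> w y) *\<^sub>R v' (?p y) = ?w y" using v'[rule_format, of "?p y"] by auto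
      qed
      moreover have "open (?p -` U)" by (intro open_vimage U continuous_intros)
      ultimately show "\<exists>U. open U \<and> x \<in> U \<and> continuous_on (cball 0 M \<inter> U) ?w"
        using U(2) by blast
    qed
    moreover have "\<exists>\<beta>. \<beta> \<noteq> 0 \<and> ?w x = \<beta> *\<^sub>R v (?p x)" if x: "x \<in> cball 0 M" for x
    proof -
      let ?q = "(real k / N) *\<^sub>R x"
      have "real k / N \<le> 1" using Suc(2) by simp
      then have "norm ?q \<le> norm x" using mult_right_mono[of "real k / N" 1 "norm x"] by simp
      then have "?q \<in> cball 0 M" using x by simp
      then obtain G where G: "good G" "ball ?q e \<subseteq> G" using e by blast
      have "?p x - ?q = (1 / N) *\<^sub>R x" by (simp add: algebra_simps add_divide_distrib)
      then have "dist (?p x) ?q \<le> \<bar>M\<bar> / N" using x by (simp add: dist_norm divide_right_mono)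
      also have "\<dots> < e" using N N0 e(1) by (simp add: field_simps)
      finally have "?p x \<in> G" "?q \<in> G" using G(2) e(1) by (auto simp: dist_commute)
      then have "v (?p x) \<bullet> v ?q \<noteq> 0" using G(1) by (auto simp: good_def)
      moreover obtain \<beta> where "\<beta> \<noteq> 0" "w x = \<beta> *\<^sub>R v ?q" using w(2) x by blast
      ultimately show ?thesis by (intro exI[of _ "v (?p x) \<bullet> w x"]) simp
    qed
    ultimately show ?case by blast
  qed
  from this[of N] show ?thesis using N0 by simp
qed

section \<open>Local signed distances\<close>

lemma GDERIV_unique:
  assumes "GDERIV f x :> D" "GDERIV f x :> E"
  shows "D = E"
proof -
  have "(\<lambda>h. h \<bullet> D) = (\<lambda>h. h \<bullet> E)"
    using assms unfolding gderiv_def by (rule has_derivative_unique)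
  then have "\<forall>h. h \<bullet> D = h \<bullet> E" by (rule fun_cong[THEN allI])
  then show ?thesis by (simp only: vector_eq_ldot)
qed

lemma gradient_eqI:
  assumes "GDERIV f x :> D"
  shows "gradient f x = D"
  unfolding gradient_def using assms GDERIV_unique[OF _ assms] by (rule the_equality)

lemma GDERIV_cong_open:
  assumes "GDERIV f x :> D" "open U" "x \<in> U" "\<And>y. y \<in> U \<Longrightarrow> f y = g y"
  shows "GDERIV g x :> D"
  using assms unfolding gderiv_def by (rule has_derivative_transform_within_open)

lemma GDERIV_continuous: "GDERIV f x :> D \<Longrightarrow> continuous (at x) f"
  unfolding gderiv_def by (rule has_derivative_continuous)

text \<open>Prescribing only \<open>\<bar>\<tau> x\<bar>\<close> leaves the sign open, so pairs can
  be compared up to a common sign. The gradient \<open>N\<close> is kept as data because the line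
  field is built from both.\<close>

definition local_signed_dist ::
  "'a::euclidean_space set \<Rightarrow> 'a set \<Rightarrow> ('a \<Rightarrow> real) \<Rightarrow> ('a \<Rightarrow> 'a) \<Rightarrow> bool" where
  "local_signed_dist Z U \<tau> N \<longleftrightarrow> open U \<and> continuous_on U N \<and>
     (\<forall>x\<in>U. GDERIV \<tau> x :> N x \<and> norm (N x) = 1 \<and> \<bar>\<tau> x\<bar> = infdist x Z)"

lemma local_signed_dist_continuous: "local_signed_dist Z U \<tau> N \<Longrightarrow> continuous_on U \<tau>"
  unfolding local_signed_dist_def by (intro continuous_at_imp_continuous_on) (blast intro: GDERIV_continuous)

lemma GDERIV_directional_limit:
  assumes "GDERIV f x :> D"
  shows "((\<lambda>t. (f (x + t *\<^sub>R h) - f x) / t) \<longlongrightarrow> h \<bullet> D) (at 0)"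
proof -
  have "((\<lambda>t. f (x + t *\<^sub>R h)) has_derivative (\<lambda>t. (t *\<^sub>R h) \<bullet> D)) (at 0)"
  proof (rule has_derivative_compose[of "\<lambda>t. x + t *\<^sub>R h" "\<lambda>t. t *\<^sub>R h" 0 UNIV f "\<lambda>h. h \<bullet> D"])
    show "((\<lambda>t. x + t *\<^sub>R h) has_derivative (\<lambda>t. t *\<^sub>R h)) (at 0)"
      by (auto intro!: derivative_eq_intros)
    show "(f has_derivative (\<lambda>h. h \<bullet> D)) (at (x + 0 *\<^sub>R h))"
      using assms by (simp add: gderiv_def)
  qed
  then have "((\<lambda>t. f (x + t *\<^sub>R h)) has_field_derivative (h \<bullet> D)) (at 0)"
    by (rule has_derivative_imp_has_field_derivative) simp
  then show ?thesis by (simp add: DERIV_def)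
qed

text \<open>Both squares equal the squared distance to \<open>Z\<close>. Where the distance is
  positive, comparing the gradients of the squares suffices; on the zero set these gradients vanish,
  and difference quotients along \<open>N x\<close> are compared instead.\<close>

lemma local_signed_dist_unique:
  assumes 1: "local_signed_dist Z U \<tau> N" "x \<in> U"
    and 2: "local_signed_dist Z U' \<tau>' N'" "x \<in> U'"
  shows "(\<tau>' x, N' x) = (\<tau> x, N x) \<or> (\<tau>' x, N' x) = - (\<tau> x, N x)"
proof -
  have U: "open (U \<inter> U')" "x \<in> U \<inter> U'" using assms by (auto simp: local_signed_dist_def)
  have g: "GDERIV \<tau> x :> N x" "GDERIV \<tau>' x :> N' x" and n: "norm (N x) = 1" "norm (N' x) = 1"
    using assms by (auto simp: local_signed_dist_def)
  have abs: "\<bar>\<tau> y\<bar> = \<bar>\<tau>' y\<bar>" if "y \<in> U \<inter> U'" for y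
    using assms that by (auto simp: local_signed_dist_def)
  then have sq: "\<tau> y * \<tau> y = \<tau>' y * \<tau>' y" if "y \<in> U \<inter> U'" for y
    using abs_mult_self_eq[of "\<tau> y"] abs_mult_self_eq[of "\<tau>' y"] abs[OF that] by simp
  show ?thesis
  proof (cases "\<tau> x = 0")
    case True
    then have 0: "\<tau> x = 0" "\<tau>' x = 0" using abs[OF U(2)] by auto
    \<comment> \<open>Since both functions vanish at \<open>x\<close> and have equal absolute values
      nearby, their squared difference quotients agree. The limits give
      \<open>\<bar>N x \<bullet> N' x\<bar> = 1\<close>, the equality case of Cauchy-Schwarz for
      unit vectors.\<close>
    have "((N x \<bullet> N x)\<^sup>2) = ((N x \<bullet> N' x)\<^sup>2)"
    proof (rule LIM_unique)
      let ?q = "\<lambda>\<tau> t. (\<tau> (x + t *\<^sub>R N x) - \<tau> x) / t"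
      show "((\<lambda>t. (?q \<tau> t)\<^sup>2) \<longlongrightarrow> (N x \<bullet> N x)\<^sup>2) (at 0)"
        by (intro tendsto_intros GDERIV_directional_limit g)
      have lim: "((\<lambda>t. (?q \<tau>' t)\<^sup>2) \<longlongrightarrow> (N x \<bullet> N' x)\<^sup>2) (at 0)"
        by (intro tendsto_intros GDERIV_directional_limit g)
      have "((\<lambda>t. x + t *\<^sub>R N x) \<longlongrightarrow> x + 0 *\<^sub>R N x) (at 0)" by (intro tendsto_intros)
      then have "\<forall>\<^sub>F t in at 0. x + t *\<^sub>R N x \<in> U \<inter> U'"
        using U by (auto dest!: topological_tendstoD)
      then have "\<forall>\<^sub>F t in at 0. (?q \<tau>' t)\<^sup>2 = (?q \<tau> t)\<^sup>2"
        by eventually_elim (simp add: 0 power_divide power2_eq_square sq)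
      from Lim_transform_eventually[OF lim this]
      show "((\<lambda>t. (?q \<tau> t)\<^sup>2) \<longlongrightarrow> (N x \<bullet> N' x)\<^sup>2) (at 0)" .
    qed
    then have "\<bar>N x \<bullet> N' x\<bar> = norm (N x) * norm (N' x)"
      using n by (auto simp: dot_square_norm power2_eq_1_iff)
    then have "N' x = N x \<or> N' x = - N x"
      unfolding norm_cauchy_schwarz_abs_eq using n by simp
    then show ?thesis using 0 by auto
  next
    case False
    have "GDERIV (\<lambda>y. \<tau> y * \<tau> y) x :> (2 * \<tau> x) *\<^sub>R N x"
      using GDERIV_mult[OF g(1) g(1)] by (simp add: scaleR_add_left[symmetric])
    then have "GDERIV (\<lambda>y. \<tau>' y * \<tau>' y) x :> (2 * \<tau> x) *\<^sub>R N x"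
      by (rule GDERIV_cong_open[OF _ U]) (rule sq)
    moreover have "GDERIV (\<lambda>y. \<tau>' y * \<tau>' y) x :> (2 * \<tau>' x) *\<^sub>R N' x"
      using GDERIV_mult[OF g(2) g(2)] by (simp add: scaleR_add_left[symmetric])
    ultimately have "(2 * \<tau> x) *\<^sub>R N x = (2 * \<tau>' x) *\<^sub>R N' x" by (rule GDERIV_unique)
    then have eq: "\<tau> x *\<^sub>R N x = \<tau>' x *\<^sub>R N' x" by (simp flip: scaleR_scaleR)
    have "\<tau>' x = \<tau> x \<or> \<tau>' x = - \<tau> x" using abs[OF U(2)] by linarith
    then show ?thesis
    proof
      assume "\<tau>' x = \<tau> x"
      then show ?thesis using eq False by simp
    next
      assume neg: "\<tau>' x = - \<tau> x"
      then have "\<tau> x *\<^sub>R N x = \<tau> x *\<^sub>R (- N' x)" using eq by simp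
      then have "N x = - N' x" using False by (simp only: scaleR_cancel_left simp_thms)
      then show ?thesis using neg by simp
    qed
  qed
qed

section \<open>The saturated signed distance\<close>

lemma DERIV_max0_sq: "((\<lambda>t::real. (max 0 t)\<^sup>2) has_real_derivative 2 * max 0 t) (at t)"
proof -
  consider "t > 0" | "t < 0" | "t = 0" by linarith
  then show ?thesis
  proof cases
    case 1
    have "((\<lambda>t. t\<^sup>2) has_real_derivative 2 * max 0 t) (at t)"
      using 1 by (auto intro!: derivative_eq_intros)
    then show ?thesis
      by (rule has_field_derivative_transform_within_open[where S = "{0<..}"]) (use 1 in auto)
  next
    case 2
    have "((\<lambda>t. 0) has_real_derivative 2 * max 0 t) (at t)"
      using 2 by (auto intro!: derivative_eq_intros)
    then show ?thesis
      by (rule has_field_derivative_transform_within_open[where S = "{..<0}"]) (use 2 in auto)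
  next
    case 3
    have "((\<lambda>h. (max 0 h)\<^sup>2 / h) \<longlongrightarrow> 0) (at (0::real))"
    proof (rule Lim_null_comparison)
      show "\<forall>\<^sub>F h in at 0. norm ((max 0 h)\<^sup>2 / h) \<le> \<bar>h::real\<bar>"
        by (rule always_eventually) (auto simp: max_def power2_eq_square)
      show "((\<lambda>h. \<bar>h::real\<bar>) \<longlongrightarrow> 0) (at 0)" by (rule tendsto_rabs_zero) simp
    qed
    then show ?thesis using 3 by (simp add: DERIV_def)
  qed
qed

text \<open>The odd primitive of the hat function \<open>max 0 (1 - \<bar>t\<bar> / r)\<close>, written as a second difference.\<close>

definition saturation :: "real \<Rightarrow> real \<Rightarrow> real" where
  "saturation r t = ((max 0 (t + r))\<^sup>2 - 2 * (max 0 t)\<^sup>2 + (max 0 (t - r))\<^sup>2) / (2 * r) - r / 2"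

lemma saturation_derivative:
  assumes "r > 0"
  shows "(saturation r has_real_derivative max 0 (1 - \<bar>t\<bar> / r)) (at t)"
proof -
  have shift: "((\<lambda>t. (max 0 (t + c))\<^sup>2) has_real_derivative 2 * max 0 (t + c)) (at t)" for c :: real
    using DERIV_max0_sq[of "t + c"] by (simp only: DERIV_shift)
  have "(saturation r has_real_derivative
      (2 * max 0 (t + r) - 2 * (2 * max 0 t) + 2 * max 0 (t - r)) / (2 * r)) (at t)"
    unfolding saturation_def [abs_def]
    using DERIV_diff[OF DERIV_cdivide[OF DERIV_add[OF
        DERIV_diff[OF shift[of r] DERIV_cmult[OF DERIV_max0_sq, of 2]] shift[of "- r"]], of "2 * r"] DERIV_const]
    by simp
  also have "(2 * max 0 (t + r) - 2 * (2 * max 0 t) + 2 * max 0 (t - r)) / (2 * r) = max 0 (1 - \<bar>t\<bar> / r)"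
    using assms by (auto simp: max_def field_simps abs_if)
  finally show ?thesis .
qed

text \<open>Completing the square expresses the value through the slope \<open>1 - t / r\<close>,
  the form in which value and gradient are later compared.\<close>

lemma saturation_eq:
  assumes "0 \<le> t" "t \<le> r" "r > 0"
  shows "saturation r t = r / 2 * (1 - (1 - t / r)\<^sup>2)"
  using assms by (simp add: saturation_def max_def field_simps power2_eq_square)

lemma saturation_const:
  assumes "r \<le> t" "r > 0"
  shows "saturation r t = r / 2"
  using assms by (simp add: saturation_def max_def field_simps power2_eq_square)

lemma saturation_pos:
  assumes "t > 0" "r > 0"
  shows "saturation r t > 0"
proof (cases "t \<le> r")
  case True
  have "(1 - t / r)\<^sup>2 < 1" using assms True by (simp add: abs_square_less_1)
  then show ?thesis using assms True by (simp add: saturation_eq)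
qed (use assms in \<open>simp add: saturation_const\<close>)

lemma saturation_minus: "r > 0 \<Longrightarrow> saturation r (- t) = - saturation r t"
  by (auto simp: saturation_def max_def field_simps power2_eq_square)

lemma saturation_sgn: "r > 0 \<Longrightarrow> saturation r t = sgn t * saturation r \<bar>t\<bar>"
  using saturation_minus[of r t] saturation_minus[of r 0] by (auto simp: sgn_if)

section \<open>Continuous differentiability from local gradients\<close>

lemma C1_on_UNIV_if_GDERIV:
  assumes "\<And>x. GDERIV f x :> G x" "continuous_on UNIV G"
  shows "C1_on f UNIV"
  unfolding C1_on_def
proof (intro conjI exI[of _ "\<lambda>x. blinfun_inner_left (G x)"] ballI)
  show "continuous_on UNIV (\<lambda>x. blinfun_inner_left (G x))"
    by (rule bounded_linear.continuous_on[OF bounded_linear_blinfun_inner_left assms(2)])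
qed (use assms(1) in \<open>auto simp: gderiv_def\<close>)

lemma C1_on_if_local_gradients:
  assumes "\<And>x. \<exists>V G. open V \<and> x \<in> V \<and> continuous_on V G \<and> (\<forall>y\<in>V. GDERIV f y :> G y)"
  shows "C1_on f UNIV"
proof (rule C1_on_UNIV_if_GDERIV)
  show "GDERIV f x :> gradient f x" for x
  proof -
    obtain D where "GDERIV f x :> D" using assms[of x] by blast
    then show ?thesis using gradient_eqI[of f x D] by simp
  qed
  show "continuous_on UNIV (gradient f)"
  proof (rule continuous_on_locally_openI)
    fix x
    obtain V G where V: "open V" "x \<in> V" "continuous_on V G" "\<forall>y\<in>V. GDERIV f y :> G y"
      using assms by blast
    have "G y = gradient f y" if "y \<in> V" for y
      using V(4) that gradient_eqI[of f y "G y"] by simp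
    then have "continuous_on V (gradient f)" by (rule continuous_on_eq[OF V(3)])
    then show "\<exists>U. open U \<and> x \<in> U \<and> continuous_on (UNIV \<inter> U) (gradient f)"
      using V(1,2) by (intro exI[of _ V]) simp
  qed
qed

section \<open>Coherent choice of signs\<close>

lemma local_signed_dist_subset:
  "local_signed_dist Z U \<tau> N \<Longrightarrow> open V \<Longrightarrow> V \<subseteq> U \<Longrightarrow> local_signed_dist Z V \<tau> N"
  by (auto simp: local_signed_dist_def intro: continuous_on_subset)

text \<open>The lines spanned by \<open>(\<tau> x, max 0 (r - infdist x Z) *\<^sub>R N x)\<close> do not depend on the choice of the
  local signed distance \<open>\<tau>\<close> and are vertical outside the \<open>r\<close>-neighbourhood of \<open>Z\<close>; the first
  component of a section of this line field is a global choice of signs.\<close>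

lemma global_sign:
  fixes Z :: "'a::euclidean_space set"
  assumes Z: "compact Z" "Z \<noteq> {}" and r: "0 < r"
    and loc: "\<forall>x. infdist x Z \<le> r \<longrightarrow> (\<exists>U \<tau> N. local_signed_dist Z U \<tau> N \<and> x \<in> U)"
  shows "\<exists>W :: 'a \<Rightarrow> real. continuous_on UNIV W \<and> (\<forall>x. 0 < infdist x Z \<longrightarrow> W x \<noteq> 0) \<and>
    (\<forall>x U \<tau> N. local_signed_dist Z U \<tau> N \<and> x \<in> U \<and> infdist x Z < r \<longrightarrow>
       (\<exists>V \<alpha>. open V \<and> x \<in> V \<and> V \<subseteq> U \<and> continuous_on V \<alpha> \<and>
         (\<forall>y\<in>V. \<alpha> y \<noteq> (0::real) \<and> W y = \<alpha> y * \<tau> y)))"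
proof -
  let ?d = "\<lambda>x. infdist x Z"
  from loc have "\<forall>x. \<exists>(\<tau> :: 'a \<Rightarrow> real) N. ?d x \<le> r \<longrightarrow> (\<exists>U. local_signed_dist Z U \<tau> N \<and> x \<in> U)"
    by blast
  then obtain \<tau>0 :: "'a \<Rightarrow> 'a \<Rightarrow> real" and N0
    where *: "\<And>x. ?d x \<le> r \<Longrightarrow> \<exists>U. local_signed_dist Z U (\<tau>0 x) (N0 x) \<and> x \<in> U"
    by metis
  \<comment> \<open>\<open>v\<close> takes an arbitrary representative of the line at each point,
    while \<open>v' \<tau> N\<close> is continuous on the domain of \<open>\<tau>\<close>. By
    uniqueness of local signed distances the two agree up to sign.\<close>
  define v where "v x = (if r \<le> ?d x then (?d x, 0) else (\<tau>0 x x, (r - ?d x) *\<^sub>R N0 x x))" for x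
  define v' where "v' \<tau> N x = (\<tau> x, max 0 (r - ?d x) *\<^sub>R N x)" for \<tau> :: "'a \<Rightarrow> real" and N :: "'a \<Rightarrow> 'a" and x
  have v': "v' \<tau> N x = v x \<or> v' \<tau> N x = - v x" if "local_signed_dist Z U \<tau> N" "x \<in> U" for U \<tau> N x
  proof (cases "r \<le> ?d x")
    case True
    moreover have "\<bar>\<tau> x\<bar> = ?d x" using that by (auto simp: local_signed_dist_def)
    ultimately show ?thesis by (auto simp: v_def v'_def)
  next
    case False
    then obtain U' where "local_signed_dist Z U' (\<tau>0 x) (N0 x)" "x \<in> U'" using *[of x] by auto
    from local_signed_dist_unique[OF this that] show ?thesis
      using False by (auto simp: v_def v'_def)
  qed
  have cont: "continuous_on U (v' \<tau> N)" if "local_signed_dist Z U \<tau> N" for U \<tau> N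
  proof -
    have "continuous_on U N" using that by (simp add: local_signed_dist_def)
    then show ?thesis
      unfolding v'_def by (intro continuous_intros local_signed_dist_continuous[OF that])
  qed
  have fst_v: "\<bar>fst (v x)\<bar> = ?d x" for x
    using *[of x] by (auto simp: v_def local_signed_dist_def infdist_nonneg)
  have nz: "v x \<noteq> 0" for x
  proof (cases "r \<le> ?d x")
    case False
    then have "norm (N0 x x) = 1" using *[of x] by (auto simp: local_signed_dist_def)
    then show ?thesis using False by (auto simp: v_def zero_prod_def)
  qed (use r in \<open>auto simp: v_def zero_prod_def\<close>)
  have sections: "\<exists>U u. open U \<and> x \<in> U \<and> continuous_on U u \<and> (\<forall>y\<in>U. u y = v y \<or> u y = - v y)" for x
  proof (cases "?d x \<le> r")
    case True
    then obtain U \<tau> N where U: "local_signed_dist Z U \<tau> N" "x \<in> U" using loc by blast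
    moreover have "open U" using U by (simp add: local_signed_dist_def)
    ultimately show ?thesis using cont[OF U(1)] v'[OF U(1)] by (intro exI[of _ U] exI[of _ "v' \<tau> N"]) simp
  next
    case False
    have "open {x. r < ?d x}" by (intro open_Collect_less continuous_intros)
    moreover have "continuous_on {x. r < ?d x} (\<lambda>x. (?d x, 0::'a))" by (intro continuous_intros)
    ultimately show ?thesis using False
      by (intro exI[of _ "{x. r < ?d x}"] exI[of _ "\<lambda>x. (?d x, 0)"]) (auto simp: v_def)
  qed
  obtain K where K: "\<And>z. z \<in> Z \<Longrightarrow> norm z \<le> K"
    using compact_imp_bounded[OF Z(1)] by (auto simp: bounded_iff)
  \<comment> \<open>The open ball of radius \<open>M\<close> contains every point at distance at
    most \<open>r\<close> from \<open>Z\<close>. Outside of it all lines are vertical, so a section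
    over \<open>cball 0 M\<close> is enough.\<close>
  define M where "M = \<bar>K\<bar> + r + 1"
  have M: "norm x < M" if "?d x \<le> r" for x
  proof -
    obtain z where z: "z \<in> Z" "?d x = dist x z"
      using infdist_attains_inf[OF compact_imp_closed[OF Z(1)] Z(2)] by blast
    have "norm x \<le> norm z + dist x z" using norm_triangle_ineq[of z "x - z"] by (simp add: dist_norm)
    then show ?thesis using K[OF z(1)] z(2) that by (simp add: M_def)
  qed
  have M0: "M > 0" using r by (simp add: M_def)
  obtain w where w: "continuous_on (cball 0 M) w"
    "\<forall>x\<in>cball 0 M. \<exists>\<beta>. \<beta> \<noteq> 0 \<and> w x = \<beta> *\<^sub>R v x"
    using line_field_section[of v M, OF nz sections] by blast
  \<comment> \<open>The radial retraction onto \<open>cball 0 M\<close> extends the section to the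
    whole space. Points beyond the ball go to its sphere, which is farther than \<open>r\<close>
    from \<open>Z\<close>, so the first component stays nonzero there.\<close>
  define cl where "cl x = (M / max M (norm x)) *\<^sub>R x" for x :: 'a
  have cl_in: "cl x \<in> cball 0 M" for x
    using M0 by (simp add: cl_def abs_mult max_def divide_le_eq)
  have cl_id: "cl x = x" if "norm x \<le> M" for x
    using M0 that by (simp add: cl_def max_def)
  have cl_out: "norm (cl x) = M" if "norm x > M" for x
  proof -
    have "norm x > 0" using M0 that by linarith
    then show ?thesis using M0 that by (simp add: cl_def max_def)
  qed
  have "continuous_on UNIV cl"
    unfolding cl_def using M0 by (intro continuous_intros) auto
  then have "continuous_on UNIV (\<lambda>x. fst (w (cl x)))"
    using cl_in by (intro continuous_intros continuous_on_compose2[OF w(1)]) auto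
  moreover have "fst (w (cl x)) \<noteq> 0" if "0 < ?d x" for x
  proof -
    have "0 < ?d (cl x)"
    proof (cases "norm x \<le> M")
      case False
      then show ?thesis using M[of "cl x"] cl_out[of x] r by (cases "?d (cl x) \<le> r") auto
    qed (use that cl_id in simp)
    then have "fst (v (cl x)) \<noteq> 0" using fst_v[of "cl x"] by auto
    moreover obtain \<beta> where "\<beta> \<noteq> 0" "w (cl x) = \<beta> *\<^sub>R v (cl x)" using w(2) cl_in[of x] by blast
    ultimately show ?thesis by simp
  qed
  moreover have "\<exists>V \<alpha>. open V \<and> x \<in> V \<and> V \<subseteq> U \<and> continuous_on V \<alpha> \<and>
         (\<forall>y\<in>V. \<alpha> y \<noteq> (0::real) \<and> fst (w (cl y)) = \<alpha> y * \<tau> y)"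
    if lsd: "local_signed_dist Z U \<tau> N" and x: "x \<in> U" "?d x < r" for x U \<tau> N
  proof -
    define V where "V = U \<inter> {x. ?d x < r}"
    \<comment> \<open>\<open>\<alpha> y\<close> is the coefficient of \<open>w y\<close> along the
      continuous representative \<open>v' \<tau> N y\<close>; as a quotient of inner products it is
      continuous. On \<open>V\<close> the retraction \<open>cl\<close> is the identity.\<close>
    define \<alpha> where "\<alpha> y = (w y \<bullet> v' \<tau> N y) / (v' \<tau> N y \<bullet> v' \<tau> N y)" for y
    have "open V" unfolding V_def using lsd
      by (intro open_Int open_Collect_less continuous_intros) (simp add: local_signed_dist_def)
    have VM: "norm y \<le> M" if "y \<in> V" for y using M[of y] that by (auto simp: V_def)
    have nz': "v' \<tau> N y \<noteq> 0" if "y \<in> V" for y using v'[OF lsd, of y] nz[of y] that by (auto simp: V_def)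
    have "continuous_on V \<alpha>" unfolding \<alpha>_def
      by (intro continuous_intros continuous_on_subset[OF w(1)] continuous_on_subset[OF cont[OF lsd]])
        (use VM nz' in \<open>auto simp: V_def\<close>)
    moreover have "\<alpha> y \<noteq> 0 \<and> fst (w (cl y)) = \<alpha> y * \<tau> y" if y: "y \<in> V" for y
    proof -
      obtain \<beta> where "\<beta> \<noteq> 0" "w y = \<beta> *\<^sub>R v y"
        using w(2)[rule_format, of y] VM[OF y] by auto
      then have "w y = \<beta> *\<^sub>R v' \<tau> N y \<or> w y = (- \<beta>) *\<^sub>R v' \<tau> N y"
        using v'[OF lsd, of y] y by (auto simp: V_def)
      then obtain \<gamma> where g: "\<gamma> \<in> {\<beta>, - \<beta>}" "w y = \<gamma> *\<^sub>R v' \<tau> N y"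
        by blast
      moreover from g(2) have "\<alpha> y = \<gamma>" using nz'[OF y] by (simp add: \<alpha>_def)
      moreover have "\<gamma> \<noteq> 0" using g(1) \<open>\<beta> \<noteq> 0\<close> by auto
      ultimately show ?thesis using cl_id[OF VM[OF y]] by (simp add: v'_def)
    qed
    moreover have "x \<in> V" "V \<subseteq> U" using x by (auto simp: V_def)
    ultimately show ?thesis using \<open>open V\<close> by blast
  qed
  ultimately show ?thesis by (intro exI[of _ "\<lambda>x. fst (w (cl x))"] conjI allI impI; blast)
qed

text \<open>The factor \<open>sgn (W x)\<close> can change only on \<open>Z\<close>, where oddness
  of the saturation absorbs the jump: near \<open>Z\<close> the product is a constant sign times
  \<open>saturation r (\<tau> x)\<close>. Beyond distance \<open>r\<close> it is locally constant,
  and the two regimes match because the slope vanishes at \<open>r\<close>.\<close>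

lemma saturated_signed_distance:
  fixes Z :: "'a::euclidean_space set"
  assumes Z: "compact Z" "Z \<noteq> {}" and r: "0 < r"
    and loc: "\<forall>x. infdist x Z \<le> r \<longrightarrow> (\<exists>U \<tau> N. local_signed_dist Z U \<tau> N \<and> x \<in> U)"
  shows "\<exists>f :: 'a \<Rightarrow> real. C1_on f UNIV \<and> (\<forall>x. \<bar>f x\<bar> = saturation r (infdist x Z)) \<and>
    (\<forall>x. norm (gradient f x) = max 0 (1 - infdist x Z / r))"
proof -
  let ?d = "\<lambda>x. infdist x Z"
  obtain W :: "'a \<Rightarrow> real" where W: "continuous_on UNIV W"
    "\<forall>x. 0 < ?d x \<longrightarrow> W x \<noteq> 0"
    "\<forall>x U \<tau> N. local_signed_dist Z U \<tau> N \<and> x \<in> U \<and> ?d x < r \<longrightarrow>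
       (\<exists>V \<alpha>. open V \<and> x \<in> V \<and> V \<subseteq> U \<and> continuous_on V \<alpha> \<and>
         (\<forall>y\<in>V. \<alpha> y \<noteq> (0::real) \<and> W y = \<alpha> y * \<tau> y))"
    using global_sign[OF Z r loc] by (elim exE conjE) (rule that)
  have W0: "W x \<noteq> 0" if "0 < ?d x" for x using W(2) that by simp
  define f where "f x = sgn (W x) * saturation r (?d x)" for x
  have const_sgn: "\<exists>V'. open V' \<and> x \<in> V' \<and> V' \<subseteq> V \<and> (\<forall>y\<in>V'. sgn (u y) = sgn (u x))"
    if "open V" "x \<in> V" "continuous_on V u" "u x \<noteq> 0" for V x and u :: "'a \<Rightarrow> real"
  proof -
    let ?V = "V \<inter> (\<lambda>y. u y * u x) -` {0<..}"
    have "open ?V" by (intro continuous_open_preimage continuous_intros that open_greaterThan)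
    moreover have "x \<in> ?V" using that by (simp flip: power2_eq_square)
    moreover have "\<forall>y\<in>?V. sgn (u y) = sgn (u x)" by (auto simp: zero_less_mult_iff)
    ultimately show ?thesis by blast
  qed
  have local: "\<exists>V c. open V \<and> x \<in> V \<and> \<bar>c\<bar> = 1 \<and>
     ((\<exists>\<tau> N. local_signed_dist Z V \<tau> N \<and> (\<forall>y\<in>V. f y = c * saturation r (\<tau> y))) \<or>
      (\<forall>y\<in>V. r < ?d y \<and> f y = c * (r / 2)))" for x
  proof -
    consider "?d x < r" | "?d x = r" | "?d x > r" by linarith
    then show ?thesis
    proof cases
      case 1
      then have "?d x \<le> r" by simp
      then obtain U \<tau> N where lsd: "local_signed_dist Z U \<tau> N" "x \<in> U" using loc by blast
      obtain V \<alpha> where V: "open V" "x \<in> V" "V \<subseteq> U" "continuous_on V \<alpha>"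
        "\<forall>y\<in>V. \<alpha> y \<noteq> (0::real) \<and> W y = \<alpha> y * \<tau> y" 
        using W(3)[rule_format, OF conjI[OF lsd(1) conjI[OF lsd(2) 1]]] by (elim exE conjE) (rule that)
      have \<alpha>: "\<alpha> x \<noteq> 0" using V(2,5) by blast
      obtain V' where V': "open V'" "x \<in> V'" "V' \<subseteq> V" "\<forall>y\<in>V'. sgn (\<alpha> y) = sgn (\<alpha> x)"
        using const_sgn[OF V(1,2,4) \<alpha>] by blast
      have lsd': "local_signed_dist Z V' \<tau> N"
        by (rule local_signed_dist_subset[OF lsd(1) V'(1) order_trans[OF V'(3) V(3)]])
      have "f y = sgn (\<alpha> x) * saturation r (\<tau> y)" if "y \<in> V'" for y
      proof -
        have "W y = \<alpha> y * \<tau> y" using V(5) V'(3) that by blast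
        moreover have "sgn (\<alpha> y) = sgn (\<alpha> x)" using V'(4) that by blast
        moreover have "\<bar>\<tau> y\<bar> = ?d y" using lsd' that by (simp add: local_signed_dist_def)
        ultimately show ?thesis using saturation_sgn[OF r, of "\<tau> y"] by (simp add: f_def sgn_mult)
      qed
      moreover have "\<bar>sgn (\<alpha> x)\<bar> = 1" using \<alpha> by (simp add: abs_sgn_eq)
      ultimately show ?thesis using V'(1,2) lsd' by blast
    next
      \<comment> \<open>The factorisation of \<open>W\<close> is available only below distance
        \<open>r\<close>. At distance \<open>r\<close> itself \<open>\<tau>\<close> and
        \<open>W\<close> are both nonzero, so both signs are constant nearby and \<open>c\<close> is
        their product.\<close>
      case 2
      then have "?d x \<le> r" by simp
      then obtain U \<tau> N where lsd: "local_signed_dist Z U \<tau> N" "x \<in> U" using loc by blast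
      then have U: "open U" "continuous_on U \<tau>" "\<bar>\<tau> x\<bar> = ?d x"
        using local_signed_dist_continuous[OF lsd(1)] by (simp_all add: local_signed_dist_def)
      have \<tau>: "\<tau> x \<noteq> 0" and Wx: "W x \<noteq> 0" using U(3) 2 r W0[of x] by auto
      obtain V where V: "open V" "x \<in> V" "V \<subseteq> U" "\<forall>y\<in>V. sgn (\<tau> y) = sgn (\<tau> x)"
        using const_sgn[OF U(1) lsd(2) U(2) \<tau>] by blast
      obtain V' where V': "open V'" "x \<in> V'" "V' \<subseteq> V" "\<forall>y\<in>V'. sgn (W y) = sgn (W x)"
        using const_sgn[OF V(1,2) continuous_on_subset[OF W(1) subset_UNIV] Wx] by blast
      have lsd': "local_signed_dist Z V' \<tau> N"
        by (rule local_signed_dist_subset[OF lsd(1) V'(1) order_trans[OF V'(3) V(3)]])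
      have sgn: "\<bar>sgn (\<tau> x)\<bar> = 1" "\<bar>sgn (W x)\<bar> = 1" using \<tau> Wx by (simp_all add: abs_sgn_eq)
      have "f y = (sgn (W x) * sgn (\<tau> x)) * saturation r (\<tau> y)" if "y \<in> V'" for y
      proof -
        have "sgn (W y) = sgn (W x)" using V'(4) that by blast
        moreover have "sgn (\<tau> y) = sgn (\<tau> x)" using V(4) V'(3) that by blast
        moreover have "\<bar>\<tau> y\<bar> = ?d y" using lsd' that by (simp add: local_signed_dist_def)
        moreover have "sgn (\<tau> x) * sgn (\<tau> x) = 1" using \<tau> by (simp add: sgn_if)
        ultimately show ?thesis using saturation_sgn[OF r, of "\<tau> y"] by (simp add: f_def mult.assoc[symmetric])
      qed
      moreover have "\<bar>sgn (W x) * sgn (\<tau> x)\<bar> = 1" using sgn by (simp add: abs_mult)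
      ultimately show ?thesis using V'(1,2) lsd' by blast
    next
      case 3
      have Wx: "W x \<noteq> 0" using W0[of x] 3 r by simp
      obtain V' where V': "open V'" "x \<in> V'" "\<forall>y\<in>V'. sgn (W y) = sgn (W x)"
        using const_sgn[OF open_UNIV UNIV_I W(1) Wx] by blast
      have "open (V' \<inter> {y. r < ?d y})" using V' by (intro open_Int open_Collect_less continuous_intros)
      moreover have "x \<in> V' \<inter> {y. r < ?d y}" using V'(2) 3 by simp
      moreover have "\<bar>sgn (W x)\<bar> = 1" using Wx by (simp add: abs_sgn_eq)
      moreover have "\<forall>y\<in>V' \<inter> {y. r < ?d y}. r < ?d y \<and> f y = sgn (W x) * (r / 2)"
      proof
        fix y assume y: "y \<in> V' \<inter> {y. r < ?d y}"
        then have "sgn (W y) = sgn (W x)" using V'(3) by blast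
        then show "r < ?d y \<and> f y = sgn (W x) * (r / 2)" using y r by (simp add: f_def saturation_const)
      qed
      ultimately show ?thesis by blast
    qed
  qed
  have grad: "\<exists>V G. open V \<and> x \<in> V \<and> continuous_on V G \<and>
     (\<forall>y\<in>V. GDERIV f y :> G y \<and> norm (G y) = max 0 (1 - ?d y / r))" for x
  proof -
    obtain V c where V: "open V" "x \<in> V" "\<bar>c\<bar> = 1" and
      cases: "(\<exists>\<tau> N. local_signed_dist Z V \<tau> N \<and> (\<forall>y\<in>V. f y = c * saturation r (\<tau> y))) \<or>
      (\<forall>y\<in>V. r < ?d y \<and> f y = c * (r / 2))" using local[of x] by blast
    from cases show ?thesis
    proof (elim disjE exE conjE)
      fix \<tau> N assume lsd: "local_signed_dist Z V \<tau> N" and f: "\<forall>y\<in>V. f y = c * saturation r (\<tau> y)"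
      let ?G = "\<lambda>y. (c * max 0 (1 - \<bar>\<tau> y\<bar> / r)) *\<^sub>R N y"
      have "continuous_on V ?G"
        using local_signed_dist_continuous[OF lsd] lsd r
        by (intro continuous_intros) (auto simp: local_signed_dist_def)
      moreover have "GDERIV f y :> ?G y" if y: "y \<in> V" for y
      proof (rule GDERIV_cong_open[OF GDERIV_DERIV_compose[where g = "\<lambda>t. c * saturation r t"] V(1) y])
        show "GDERIV \<tau> y :> N y" using lsd y by (simp add: local_signed_dist_def)
        show "((\<lambda>t. c * saturation r t) has_real_derivative c * max 0 (1 - \<bar>\<tau> y\<bar> / r)) (at (\<tau> y))"
          by (intro DERIV_cmult saturation_derivative r)
      qed (use f in simp)
      moreover have "norm (?G y) = max 0 (1 - ?d y / r)" if y: "y \<in> V" for y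
        using lsd y V(3) by (simp add: local_signed_dist_def abs_mult)
      ultimately show ?thesis using V(1,2) by blast
    next
      assume f: "\<forall>y\<in>V. r < ?d y \<and> f y = c * (r / 2)"
      have "GDERIV f y :> 0" if "y \<in> V" for y
        by (rule GDERIV_cong_open[OF GDERIV_const[where k = "c * (r / 2)"] V(1) that]) (use f in simp)
      moreover have "norm (0 :: 'a) = max 0 (1 - ?d y / r)" if "y \<in> V" for y
      proof -
        have "r < ?d y" using f that by blast
        then show ?thesis using r by (simp add: max_def le_divide_eq)
      qed
      moreover have "continuous_on V (\<lambda>_. 0 :: 'a)" by (rule continuous_on_const)
      ultimately show ?thesis using V(1,2) by blast
    qed
  qed
  have abs: "\<bar>f x\<bar> = saturation r (?d x)" for x
  proof (cases "?d x = 0")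
    case True
    then show ?thesis using r by (simp add: f_def saturation_eq)
  next
    case False
    then have "?d x > 0" using infdist_nonneg[of x Z] by simp
    then show ?thesis using W0[of x] saturation_pos[OF _ r, of "?d x"]
      by (simp add: f_def abs_mult abs_sgn_eq)
  qed
  have C1: "C1_on f UNIV"
  proof (rule C1_on_if_local_gradients)
    show "\<exists>V G. open V \<and> x \<in> V \<and> continuous_on V G \<and> (\<forall>y\<in>V. GDERIV f y :> G y)" for x
      using grad[of x] by blast
  qed
  have norm_grad: "norm (gradient f x) = max 0 (1 - ?d x / r)" for x
  proof -
    obtain V G where "x \<in> V" "\<forall>y\<in>V. GDERIV f y :> G y \<and> norm (G y) = max 0 (1 - ?d y / r)"
      using grad[of x] by (elim exE conjE) (rule that)
    then have "GDERIV f x :> G x" "norm (G x) = max 0 (1 - ?d x / r)" by blast+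
    then show ?thesis by (simp only: gradient_eqI)
  qed
  show ?thesis using C1 abs norm_grad by blast
qed

section \<open>The distance to a hypersurface of positive reach\<close>

lemma infdist_closest_point:
  assumes "closed S" "S \<noteq> {}"
  shows "infdist x S = dist x (closest_point S x)"
proof -
  obtain z where z: "z \<in> S" "infdist x S = dist x z" using infdist_attains_inf[OF assms] by blast
  then show ?thesis
    using closest_point_le[OF assms(1) z(1), of x] infdist_le[OF closest_point_in_set[OF assms, of x], of x]
    by simp
qed

text \<open>Uniqueness makes the graph over \<open>S\<close> the set of all \<open>(x, z)\<close> in
  \<open>S \<times> Z\<close> with \<open>infdist x Z = dist x z\<close>, which is relatively
  closed; a closed graph into a compact set yields continuity.\<close>

lemma continuous_on_closest_point_unique:
  fixes Z :: "'a::euclidean_space set"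
  assumes Z: "compact Z" "Z \<noteq> {}"
    and unique: "\<And>x. x \<in> S \<Longrightarrow> \<exists>!z. z \<in> Z \<and> infdist x Z = dist x z"
  shows "continuous_on S (closest_point Z)"
proof -
  note cp = closest_point_in_set[OF compact_imp_closed[OF Z(1)] Z(2)]
    infdist_closest_point[OF compact_imp_closed[OF Z(1)] Z(2)]
  have "(\<lambda>x. (x, closest_point Z x)) ` S = (S \<times> Z) \<inter> {p. infdist (fst p) Z = dist (fst p) (snd p)}"
  proof (intro equalityI subsetI)
    fix p assume p: "p \<in> (S \<times> Z) \<inter> {p. infdist (fst p) Z = dist (fst p) (snd p)}"
    then have "snd p = closest_point Z (fst p)" using unique[of "fst p"] cp[of "fst p"] by auto
    then have "p = (fst p, closest_point Z (fst p))" by (metis prod.collapse)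
    moreover have "fst p \<in> S" using p by auto
    ultimately show "p \<in> (\<lambda>x. (x, closest_point Z x)) ` S" by blast
  qed (use cp in auto)
  moreover have "closed {p::'a \<times> 'a. infdist (fst p) Z = dist (fst p) (snd p)}"
    by (intro closed_Collect_eq continuous_intros)
  ultimately have "closedin (top_of_set (S \<times> Z)) ((\<lambda>x. (x, closest_point Z x)) ` S)"
    by (simp add: closedin_closed_Int)
  then show ?thesis using continuous_closed_graph_eq[OF Z(1)] cp(1) by blast
qed

lemma GDERIV_altI:
  assumes "\<And>e. e > 0 \<Longrightarrow> \<exists>d>0. \<forall>y. norm (y - x) < d \<longrightarrow> \<bar>f y - f x - (y - x) \<bullet> D\<bar> \<le> e * norm (y - x)"
  shows "GDERIV f x :> D"
  unfolding gderiv_def has_derivative_at_alt using assms by (auto intro: bounded_linear_inner_left)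

text \<open>The foot of \<open>x\<close> as a competitor at \<open>y\<close> bounds the increment
  from above, with an error of \<open>norm (y - x)\<close> squared. The foot of \<open>y\<close> as
  a competitor at \<open>x\<close> bounds it from below, with an error controlled by continuity of
  the projection.\<close>

lemma GDERIV_infdist_sq:
  fixes Z :: "'a::euclidean_space set"
  assumes Z: "closed Z" "Z \<noteq> {}" and cont: "continuous (at x) (closest_point Z)"
  shows "GDERIV (\<lambda>x. (infdist x Z)\<^sup>2) x :> 2 *\<^sub>R (x - closest_point Z x)"
proof (rule GDERIV_altI)
  let ?\<pi> = "closest_point Z"
  fix e :: real assume e: "e > 0"
  then obtain d where d: "d > 0" "\<And>y. dist y x < d \<Longrightarrow> dist (?\<pi> y) (?\<pi> x) < e / 2"
    using cont unfolding continuous_at_eps_delta by (metis half_gt_zero)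
  have "\<bar>(infdist y Z)\<^sup>2 - (infdist x Z)\<^sup>2 - (y - x) \<bullet> (2 *\<^sub>R (x - ?\<pi> x))\<bar> \<le> e * norm (y - x)"
    if y: "norm (y - x) < min d e" for y
  proof -
    have sq: "(infdist w Z)\<^sup>2 = (w - ?\<pi> w) \<bullet> (w - ?\<pi> w)" for w
      by (simp add: infdist_closest_point[OF Z] dist_norm dot_square_norm)
    have le: "(infdist w Z)\<^sup>2 \<le> (w - ?\<pi> z) \<bullet> (w - ?\<pi> z)" for w z
    proof -
      have "infdist w Z \<le> dist w (?\<pi> z)" by (rule infdist_le[OF closest_point_in_set[OF Z]])
      from power_mono[OF this infdist_nonneg, of 2] show ?thesis by (simp add: dist_norm dot_square_norm)
    qed
    have "(infdist y Z)\<^sup>2 - (infdist x Z)\<^sup>2 - (y - x) \<bullet> (2 *\<^sub>R (x - ?\<pi> x)) \<le> (y - x) \<bullet> (y - x)"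
      using le[of y x] unfolding sq[of x] by (simp add: algebra_simps inner_commute)
    also have "\<dots> = norm (y - x) * norm (y - x)" by (simp add: dot_square_norm power2_eq_square)
    also have "\<dots> \<le> e * norm (y - x)" using y by (intro mult_right_mono) auto
    finally have up: "(infdist y Z)\<^sup>2 - (infdist x Z)\<^sup>2 - (y - x) \<bullet> (2 *\<^sub>R (x - ?\<pi> x)) \<le> e * norm (y - x)" .
    have "\<bar>2 * ((y - x) \<bullet> (?\<pi> x - ?\<pi> y))\<bar> \<le> 2 * (norm (y - x) * norm (?\<pi> x - ?\<pi> y))"
      using Cauchy_Schwarz_ineq2[of "y - x" "?\<pi> x - ?\<pi> y"] by simp
    also have "\<dots> \<le> 2 * (norm (y - x) * (e / 2))"
      using d(2)[of y] y by (intro mult_left_mono) (auto simp: dist_norm norm_minus_commute)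
    finally have "- (e * norm (y - x)) \<le> 2 * ((y - x) \<bullet> (?\<pi> x - ?\<pi> y))" by (simp add: mult.commute)
    also have "\<dots> \<le> (infdist y Z)\<^sup>2 - (infdist x Z)\<^sup>2 - (y - x) \<bullet> (2 *\<^sub>R (x - ?\<pi> x))"
      using le[of x y] inner_ge_zero[of "y - x"] unfolding sq[of y]
      by (simp add: algebra_simps inner_commute del: inner_ge_zero)
    finally show ?thesis using up by linarith
  qed
  then show "\<exists>d>0. \<forall>y. norm (y - x) < d \<longrightarrow>
      \<bar>(infdist y Z)\<^sup>2 - (infdist x Z)\<^sup>2 - (y - x) \<bullet> (2 *\<^sub>R (x - ?\<pi> x))\<bar> \<le> e * norm (y - x)"
    using d(1) e by (intro exI[of _ "min d e"]) simp
qed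

lemma GDERIV_infdist:
  fixes Z :: "'a::euclidean_space set"
  assumes "closed Z" "Z \<noteq> {}" "continuous (at x) (closest_point Z)" and pos: "infdist x Z > 0"
  shows "GDERIV (\<lambda>x. infdist x Z) x :> (1 / infdist x Z) *\<^sub>R (x - closest_point Z x)"
proof -
  have "GDERIV (\<lambda>x. sqrt ((infdist x Z)\<^sup>2)) x :>
      (inverse (sqrt ((infdist x Z)\<^sup>2)) / 2) *\<^sub>R (2 *\<^sub>R (x - closest_point Z x))"
    using pos by (intro GDERIV_DERIV_compose GDERIV_infdist_sq assms DERIV_real_sqrt) simp
  then show ?thesis using pos by (simp add: infdist_nonneg inverse_eq_divide)
qed

text \<open>The function is the chart coordinate that vanishes on \<open>Z\<close>, and
  \<open>n\<close> is its gradient. Tangent vectors at \<open>q\<close> are velocities of curves in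
  \<open>Z\<close>, so if \<open>q\<close> is nearest to \<open>x\<close>, then \<open>x - q\<close>
  is orthogonal to them and hence a multiple of \<open>n q\<close>.\<close>

lemma hypersurface_defining_function:
  fixes Z :: "'a::euclidean_space set"
  assumes "C1_hypersurface Z" "p \<in> Z"
  obtains U g n where "open U" "p \<in> U" "continuous_on U n"
    "\<And>q. q \<in> U \<Longrightarrow> GDERIV g q :> n q" "\<And>q. q \<in> U \<Longrightarrow> n q \<noteq> 0"
    "\<And>q. q \<in> U \<Longrightarrow> q \<in> Z \<Longrightarrow> g q = 0"
    "\<And>q x. q \<in> U \<Longrightarrow> q \<in> Z \<Longrightarrow> (\<And>z. z \<in> Z \<Longrightarrow> dist x q \<le> dist x z) \<Longrightarrow> \<exists>c. x - q = c *\<^sub>R n q"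
proof -
  obtain U V and \<phi> \<psi> :: "'a \<Rightarrow> 'a" and b where b: "b \<in> Basis" and p: "p \<in> U"
    and homeo: "homeomorphism U V \<phi> \<psi>" and C1: "C1_on \<phi> U" "C1_on \<psi> V"
    and slice: "\<phi> ` (U \<inter> Z) = V \<inter> {y. y \<bullet> b = 0}"
    using assms unfolding C1_hypersurface_def by blast
  obtain \<phi>' where U: "open U" and \<phi>': "\<And>x. x \<in> U \<Longrightarrow> (\<phi> has_derivative blinfun_apply (\<phi>' x)) (at x)"
    "continuous_on U \<phi>'" using C1(1) unfolding C1_on_def by blast
  obtain \<psi>' where V: "open V" and \<psi>': "\<And>x. x \<in> V \<Longrightarrow> (\<psi> has_derivative blinfun_apply (\<psi>' x)) (at x)"
    using C1(2) unfolding C1_on_def by blast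
  have inv: "\<And>x. x \<in> U \<Longrightarrow> \<psi> (\<phi> x) = x" "\<And>y. y \<in> V \<Longrightarrow> \<phi> (\<psi> y) = y"
    and in_V: "\<And>x. x \<in> U \<Longrightarrow> \<phi> x \<in> V" and in_U: "\<And>y. y \<in> V \<Longrightarrow> \<psi> y \<in> U"
    using homeo unfolding homeomorphism_def by auto
  have \<phi>\<psi>': "\<phi>' q (\<psi>' (\<phi> q) k) = k" if q: "q \<in> U" for q k
  proof -
    have "((\<lambda>y. \<phi> (\<psi> y)) has_derivative (\<lambda>k. \<phi>' q (\<psi>' (\<phi> q) k))) (at (\<phi> q))"
      by (rule has_derivative_compose[OF \<psi>'[OF in_V[OF q]]]) (simp add: inv q \<phi>')
    then have "((\<lambda>y. y) has_derivative (\<lambda>k. \<phi>' q (\<psi>' (\<phi> q) k))) (at (\<phi> q))"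
      by (rule has_derivative_transform_within_open[OF _ V in_V[OF q]]) (rule inv(2))
    from has_derivative_unique[OF this has_derivative_ident] show ?thesis by meson
  qed
  have \<psi>\<phi>': "\<psi>' (\<phi> q) (\<phi>' q h) = h" if q: "q \<in> U" for q h
  proof -
    have "((\<lambda>x. \<psi> (\<phi> x)) has_derivative (\<lambda>k. \<psi>' (\<phi> q) (\<phi>' q k))) (at q)"
      by (rule has_derivative_compose[OF \<phi>'(1)[OF q] \<psi>'[OF in_V[OF q]]])
    then have "((\<lambda>y. y) has_derivative (\<lambda>k. \<psi>' (\<phi> q) (\<phi>' q k))) (at q)"
      by (rule has_derivative_transform_within_open[OF _ U q]) (rule inv(1))
    from has_derivative_unique[OF this has_derivative_ident] show ?thesis by meson
  qed
  \<comment> \<open>\<open>n q\<close> is the adjoint of \<open>\<phi>' q\<close> applied to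
    \<open>b\<close>; expanding it in the standard basis lets its continuity follow from that of
    \<open>\<phi>'\<close>.\<close>
  define n where "n q = (\<Sum>i\<in>Basis. (\<phi>' q i \<bullet> b) *\<^sub>R i)" for q
  have n: "h \<bullet> n q = \<phi>' q h \<bullet> b" for h q
  proof -
    have "\<phi>' q h = \<phi>' q (\<Sum>i\<in>Basis. (h \<bullet> i) *\<^sub>R i)" by (simp add: euclidean_representation)
    also have "\<dots> = (\<Sum>i\<in>Basis. (h \<bullet> i) *\<^sub>R \<phi>' q i)" by (simp add: blinfun.sum_right blinfun.scaleR_right)
    finally show ?thesis by (simp add: n_def inner_sum_left inner_sum_right mult.commute)
  qed
  show ?thesis
  proof (rule that[of U n "\<lambda>q. \<phi> q \<bullet> b"])
    show "continuous_on U n" unfolding n_def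
      by (intro continuous_intros blinfun.continuous_on \<phi>')
    show "GDERIV (\<lambda>q. \<phi> q \<bullet> b) q :> n q" if "q \<in> U" for q
      unfolding gderiv_def n by (rule has_derivative_inner_left[OF \<phi>'(1)[OF that]])
    show "n q \<noteq> 0" if "q \<in> U" for q
    proof -
      have "\<psi>' (\<phi> q) b \<bullet> n q = 1" using b by (simp add: n \<phi>\<psi>' that)
      then show ?thesis by auto
    qed
    show "\<phi> q \<bullet> b = 0" if "q \<in> U" "q \<in> Z" for q using slice that by blast
    show "\<exists>c. x - q = c *\<^sub>R n q"
      if q: "q \<in> U" "q \<in> Z" and nearest: "\<And>z. z \<in> Z \<Longrightarrow> dist x q \<le> dist x z" for q x
    proof -
      have perp: "(x - q) \<bullet> h = 0" if h: "h \<bullet> n q = 0" for h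
      proof -
        define u where "u = \<phi>' q h"
        have u: "u \<bullet> b = 0" using h by (simp add: n u_def)
        have q0: "\<phi> q \<in> V" "\<phi> q \<bullet> b = 0" using slice q by blast+
        \<comment> \<open>A segment in the slice hyperplane, pulled back by \<open>\<psi>\<close>,
          is a curve in \<open>Z\<close> through \<open>q\<close> with velocity \<open>h\<close>.
          The squared distance from \<open>x\<close> along it is minimal at \<open>t = 0\<close>, so
          its derivative there vanishes.\<close>
        let ?l = "\<lambda>t::real. \<phi> q + t *\<^sub>R u"
        have "continuous_on UNIV ?l" by (intro continuous_intros)
        then have "open (?l -` V)" using V by (simp add: open_vimage)
        moreover have "0 \<in> ?l -` V" using q0 by simp
        ultimately obtain d where d: "d > 0" "ball 0 d \<subseteq> ?l -` V" by (meson openE)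
        have in_Z: "\<psi> (?l t) \<in> Z" if "\<bar>t\<bar> < d" for t
        proof -
          have "?l t \<in> V \<inter> {y. y \<bullet> b = 0}" using d(2) that q0 u by (auto simp: inner_add_left)
          then obtain z where "z \<in> U \<inter> Z" "?l t = \<phi> z" unfolding slice[symmetric] by blast
          then show ?thesis using inv(1) by auto
        qed
        let ?F = "\<lambda>t. (x - \<psi> (?l t)) \<bullet> (x - \<psi> (?l t))"
        have l': "(?l has_derivative (\<lambda>t. t *\<^sub>R u)) (at 0)" by (auto intro!: derivative_eq_intros)
        have \<psi>_at: "(\<psi> has_derivative \<psi>' (\<phi> q)) (at (?l 0))" using \<psi>'[OF q0(1)] by simp
        have "((\<lambda>t. x - \<psi> (?l t)) has_derivative (\<lambda>t. - (t *\<^sub>R h))) (at 0)"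
          using has_derivative_diff[OF has_derivative_const[of x] has_derivative_compose[OF l' \<psi>_at]]
          by (simp add: blinfun.scaleR_right u_def \<psi>\<phi>' q)
        from has_derivative_inner[OF this this]
        have "(?F has_derivative (\<lambda>t. t * (- 2 * ((x - q) \<bullet> h)))) (at 0)"
          by (simp add: inv q inner_commute algebra_simps)
        then have "(?F has_field_derivative - 2 * ((x - q) \<bullet> h)) (at 0)"
          by (rule has_derivative_imp_has_field_derivative) (simp add: mult.commute)
        moreover have "?F 0 \<le> ?F t" if "\<bar>0 - t\<bar> < d" for t
          using nearest[OF in_Z, of t] that
          by (simp add: inv q dist_norm dot_square_norm power_mono)
        ultimately have "- 2 * ((x - q) \<bullet> h) = 0" using d(1) by (intro DERIV_local_min) auto
        then show ?thesis by simp
      qed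
      \<comment> \<open>Removing the component along \<open>n q\<close> leaves a vector
        \<open>h\<close> orthogonal to both \<open>n q\<close> and \<open>x - q\<close>, hence to
        itself.\<close>
      define c where "c = ((x - q) \<bullet> n q) / (n q \<bullet> n q)"
      define h where "h = (x - q) - c *\<^sub>R n q"
      have hn: "h \<bullet> n q = 0" using \<open>q \<in> U \<Longrightarrow> n q \<noteq> 0\<close> q by (simp add: h_def c_def inner_diff_left)
      have "h \<bullet> h = (x - q) \<bullet> h - c * (h \<bullet> n q)" by (simp add: h_def inner_diff_left inner_commute)
      then have "h = 0" using perp[OF hn] hn by simp
      then show ?thesis by (auto simp: h_def)
    qed
  qed (use U p in auto)
qed

lemma local_signed_dist_off:
  fixes Z :: "'a::euclidean_space set"
  assumes Z: "compact Z" "Z \<noteq> {}"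
    and cont: "continuous_on {x. infdist x Z < s} (closest_point Z)"
  shows "local_signed_dist Z {x. 0 < infdist x Z \<and> infdist x Z < s} (\<lambda>x. infdist x Z)
    (\<lambda>x. (1 / infdist x Z) *\<^sub>R (x - closest_point Z x))"
proof -
  let ?U = "{x. 0 < infdist x Z \<and> infdist x Z < s}"
  note closed = compact_imp_closed[OF Z(1)]
  have "open {x. infdist x Z < s}" by (intro open_Collect_less continuous_intros)
  then have at: "continuous (at x) (closest_point Z)" if "x \<in> ?U" for x
    using cont that by (simp add: continuous_on_eq_continuous_at)
  have "open ?U" by (intro open_Collect_conj open_Collect_less continuous_intros)
  moreover have "continuous_on ?U (\<lambda>x. (1 / infdist x Z) *\<^sub>R (x - closest_point Z x))"
    by (intro continuous_intros continuous_on_subset[OF cont]) auto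
  moreover have "norm ((1 / infdist x Z) *\<^sub>R (x - closest_point Z x)) = 1" if "x \<in> ?U" for x
    using that infdist_closest_point[OF closed Z(2), of x] by (auto simp: dist_norm)
  ultimately show ?thesis
    unfolding local_signed_dist_def using GDERIV_infdist[OF closed Z(2) at] by (simp add: infdist_nonneg)
qed

text \<open>Near \<open>p \<in> Z\<close> the signed distance is \<open>(x - \<pi> x) \<bullet> \<nu> (\<pi> x)\<close>, where \<open>\<pi>\<close> is the nearest point projection
  and \<open>\<nu>\<close> a continuous unit normal; its gradient is \<open>\<nu> (\<pi> x)\<close>.\<close>

lemma local_signed_dist_at:
  fixes Z :: "'a::euclidean_space set"
  assumes Z: "compact Z" "C1_hypersurface Z" "p \<in> Z" and "0 < s"
    and cont: "continuous_on {x. infdist x Z < s} (closest_point Z)"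
  shows "\<exists>U \<tau> N. local_signed_dist Z U \<tau> N \<and> p \<in> U"
proof -
  let ?\<pi> = "closest_point Z" and ?S = "{x. infdist x Z < s}"
  have ne: "Z \<noteq> {}" using Z(3) by blast
  note closed = compact_imp_closed[OF Z(1)]
  note in_Z = closest_point_in_set[OF closed ne]
  note dist_\<pi> = infdist_closest_point[OF closed ne]
  have S: "open ?S" by (intro open_Collect_less continuous_intros)
  obtain U g n where U: "open U" "p \<in> U" "continuous_on U n"
    and g': "\<And>q. q \<in> U \<Longrightarrow> GDERIV g q :> n q" and n: "\<And>q. q \<in> U \<Longrightarrow> n q \<noteq> 0"
    and g: "\<And>q. q \<in> U \<Longrightarrow> q \<in> Z \<Longrightarrow> g q = 0"
    and normal: "\<And>q x. q \<in> U \<Longrightarrow> q \<in> Z \<Longrightarrow> (\<And>z. z \<in> Z \<Longrightarrow> dist x q \<le> dist x z) \<Longrightarrow> \<exists>c. x - q = c *\<^sub>R n q"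
    using hypersurface_defining_function[OF Z(2,3)] by metis
  define V where "V = ?S \<inter> ?\<pi> -` U"
  have V: "open V" unfolding V_def by (rule continuous_open_preimage[OF cont S U(1)])
  have "p \<in> V" using Z(3) U(2) \<open>0 < s\<close> by (simp add: V_def closest_point_self)
  have \<pi>_U: "?\<pi> x \<in> U" if "x \<in> V" for x using that by (simp add: V_def)
  define N where "N x = n (?\<pi> x) /\<^sub>R norm (n (?\<pi> x))" for x
  define \<tau> where "\<tau> x = (x - ?\<pi> x) \<bullet> N x" for x
  have cont\<pi>: "continuous_on V ?\<pi>" by (rule continuous_on_subset[OF cont]) (auto simp: V_def)
  have contN: "continuous_on V N" unfolding N_def
    by (intro continuous_intros continuous_on_compose2[OF U(3) cont\<pi>]) (use \<pi>_U n in auto)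
  have cont\<tau>: "continuous_on V \<tau>" unfolding \<tau>_def by (intro continuous_intros contN cont\<pi>)
  have N1: "norm (N x) = 1" if "x \<in> V" for x using n[OF \<pi>_U[OF that]] by (simp add: N_def)
  have \<tau>N: "x - ?\<pi> x = \<tau> x *\<^sub>R N x" if x: "x \<in> V" for x
  proof -
    obtain c where c: "x - ?\<pi> x = c *\<^sub>R n (?\<pi> x)"
      using normal[OF \<pi>_U[OF x] in_Z] closest_point_le[OF closed] by blast
    then have c': "x - ?\<pi> x = (c * norm (n (?\<pi> x))) *\<^sub>R N x" using n[OF \<pi>_U[OF x]] by (simp add: N_def)
    then have "\<tau> x = c * norm (n (?\<pi> x))" using N1[OF x] by (simp add: \<tau>_def dot_square_norm)
    then show ?thesis using c' by simp
  qed
  have abs\<tau>: "\<bar>\<tau> x\<bar> = infdist x Z" if x: "x \<in> V" for x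
    using arg_cong[OF \<tau>N[OF x], of norm] N1[OF x] by (simp add: dist_\<pi> dist_norm)
  have "GDERIV \<tau> x :> N x" if x: "x \<in> V" for x
  proof (cases "\<tau> x = 0")
    case False
    \<comment> \<open>On \<open>?W\<close> the sign of \<open>\<tau>\<close> is constant, so
      \<open>\<tau>\<close> is a constant multiple of the distance and inherits its
      derivative.\<close>
    let ?W = "V \<inter> (\<lambda>y. \<tau> y * \<tau> x) -` {0<..}"
    have d: "infdist x Z > 0" using abs\<tau>[OF x] False by linarith
    have "continuous (at x) ?\<pi>" using cont S x by (simp add: V_def continuous_on_eq_continuous_at)
    from GDERIV_infdist[OF closed ne this d]
    have "GDERIV (\<lambda>x. infdist x Z) x :> (1 / infdist x Z) *\<^sub>R (x - ?\<pi> x)" .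
    from GDERIV_DERIV_compose[OF this DERIV_cmult_Id[of "sgn (\<tau> x)"]]
    have "GDERIV (\<lambda>y. sgn (\<tau> x) * infdist y Z) x :> sgn (\<tau> x) *\<^sub>R ((1 / infdist x Z) *\<^sub>R (x - ?\<pi> x))" .
    moreover have "sgn (\<tau> x) *\<^sub>R ((1 / infdist x Z) *\<^sub>R (x - ?\<pi> x)) = N x"
      using False by (simp add: abs\<tau>[OF x, symmetric] \<tau>N[OF x] sgn_if)
    ultimately have "GDERIV (\<lambda>y. sgn (\<tau> x) * infdist y Z) x :> N x" by (rule GDERIV_subst)
    moreover have "open ?W" by (intro continuous_open_preimage continuous_intros cont\<tau> V open_greaterThan)
    moreover have "x \<in> ?W" using x False by (simp flip: power2_eq_square)
    moreover have "sgn (\<tau> x) * infdist y Z = \<tau> y" if "y \<in> ?W" for y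
    proof -
      have "sgn (\<tau> x) = sgn (\<tau> y)" using that by (auto simp: zero_less_mult_iff)
      moreover have "infdist y Z = \<bar>\<tau> y\<bar>" using that abs\<tau>[of y] by simp
      ultimately show ?thesis by (simp only: sgn_mult_abs)
    qed
    ultimately show ?thesis by (rule GDERIV_cong_open)
  next
    case True
    then have "infdist x Z = 0" using abs\<tau>[OF x] by simp
    then have \<pi>x: "?\<pi> x = x" using dist_\<pi>[of x] by simp
    then have xU: "x \<in> U" and xZ: "x \<in> Z" using \<pi>_U[OF x] in_Z[of x] by auto
    have Nx: "N x = n x /\<^sub>R norm (n x)" by (simp add: N_def \<pi>x)
    \<comment> \<open>\<open>N\<close> is only known to be continuous, so the product defining
      \<open>\<tau>\<close> cannot be differentiated directly. With \<open>z\<close> the foot of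
      \<open>y\<close>, the error is
      \<open>\<tau> y * (1 - N y \<bullet> N x) - (z - x) \<bullet> N x\<close>: the first term is
      small by continuity of \<open>N\<close>, the second because \<open>g\<close> vanishes at
      \<open>z\<close> and \<open>x\<close>, which makes \<open>z - x\<close> almost
      tangent.\<close>
    show ?thesis
    proof (rule GDERIV_altI)
      fix e :: real assume e: "e > 0"
      have "continuous (at x) N" using contN V x by (simp add: continuous_on_eq_continuous_at)
      then obtain d1 where d1: "d1 > 0" "\<forall>y. dist y x < d1 \<longrightarrow> dist (N y) (N x) < e / 2"
        unfolding continuous_at_eps_delta using half_gt_zero[OF e] by blast
      \<comment> \<open>The factor \<open>norm (n x)\<close> undoes the normalisation in
        \<open>N x\<close>. The foot of \<open>y\<close> may be twice as far from \<open>x\<close>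
        as \<open>y\<close> is, whence \<open>e / 4\<close> here and \<open>d2 / 2\<close>
        below.\<close>
      have "e / 4 * norm (n x) > 0" using e n[OF xU] by simp
      then obtain d2 where d2: "d2 > 0" "\<forall>z. norm (z - x) < d2 \<longrightarrow>
          norm (g z - g x - (z - x) \<bullet> n x) \<le> e / 4 * norm (n x) * norm (z - x)"
        using g'[OF xU] unfolding gderiv_def has_derivative_at_alt by blast
      obtain d3 where d3: "d3 > 0" "ball x d3 \<subseteq> V" using V x by (meson openE)
      have "\<bar>\<tau> y - \<tau> x - (y - x) \<bullet> N x\<bar> \<le> e * norm (y - x)"
        if y: "norm (y - x) < min d1 (min (d2 / 2) d3)" for y
      proof -
        let ?z = "?\<pi> y"
        have yV: "y \<in> V" using d3(2) y by (auto simp: dist_norm norm_minus_commute)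
        have "\<bar>\<tau> y\<bar> \<le> norm (y - x)" using infdist_le[OF xZ, of y] abs\<tau>[OF yV] by (simp add: dist_norm)
        have "norm (?z - x) \<le> norm (y - x) + infdist y Z"
          using norm_triangle_ineq[of "?z - y" "y - x"] by (simp add: dist_\<pi> dist_norm norm_minus_commute)
        then have z: "norm (?z - x) \<le> 2 * norm (y - x)"
          using \<open>\<bar>\<tau> y\<bar> \<le> norm (y - x)\<close> abs\<tau>[OF yV] by linarith
        then have "norm (?z - x) < d2" using y by linarith
        then have "\<bar>(?z - x) \<bullet> n x\<bar> \<le> e / 4 * norm (n x) * norm (?z - x)"
          using d2(2)[rule_format, of ?z] g[OF xU xZ] g[OF \<pi>_U[OF yV] in_Z] by simp
        then have "\<bar>(?z - x) \<bullet> N x\<bar> \<le> e / 4 * norm (?z - x)"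
          using n[OF xU] by (simp add: Nx abs_mult divide_simps mult.commute mult.left_commute)
        also have "\<dots> \<le> e / 4 * (2 * norm (y - x))" using z e by (intro mult_left_mono) auto
        finally have tangential: "\<bar>(?z - x) \<bullet> N x\<bar> \<le> e / 2 * norm (y - x)" by simp
        have "1 - N y \<bullet> N x = (N x - N y) \<bullet> N x" using N1[OF x] by (simp add: inner_diff_left dot_square_norm)
        also have "\<bar>\<dots>\<bar> \<le> norm (N x - N y) * norm (N x)" by (rule Cauchy_Schwarz_ineq2)
        also have "\<dots> \<le> e / 2"
          using d1(2)[rule_format, of y] y N1[OF x] by (simp add: dist_norm norm_minus_commute)
        finally have "\<bar>\<tau> y * (1 - N y \<bullet> N x)\<bar> \<le> norm (y - x) * (e / 2)"
          unfolding abs_mult using \<open>\<bar>\<tau> y\<bar> \<le> norm (y - x)\<close> by (intro mult_mono) auto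
        moreover have "(y - x) \<bullet> N x = \<tau> y * (N y \<bullet> N x) + (?z - x) \<bullet> N x"
          using arg_cong[OF \<tau>N[OF yV], of "\<lambda>w. w \<bullet> N x"] by (simp add: inner_diff_left)
        then have "\<tau> y - \<tau> x - (y - x) \<bullet> N x = \<tau> y * (1 - N y \<bullet> N x) - (?z - x) \<bullet> N x"
          using True by (simp add: algebra_simps)
        ultimately show ?thesis using tangential by (simp add: mult.commute)
      qed
      then show "\<exists>d>0. \<forall>y. norm (y - x) < d \<longrightarrow> \<bar>\<tau> y - \<tau> x - (y - x) \<bullet> N x\<bar> \<le> e * norm (y - x)"
        using d1(1) d2(1) d3(1) by (intro exI[of _ "min d1 (min (d2 / 2) d3)"]) simp
    qed
  qed
  then show ?thesis using V contN N1 abs\<tau> \<open>p \<in> V\<close> unfolding local_signed_dist_def by blast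
qed

section \<open>Condition numbers\<close>

lemma reachD:
  assumes "ereal r < reach Z"
  shows "\<exists>s. r < s \<and> 0 < s \<and> (\<forall>x. infdist x Z < s \<longrightarrow> (\<exists>!z. z \<in> Z \<and> infdist x Z = dist x z))"
proof -
  obtain s where "ereal r < ereal s" "0 < s"
    "\<forall>x. infdist x Z < s \<longrightarrow> (\<exists>!z. z \<in> Z \<and> infdist x Z = dist x z)"
    using assms unfolding reach_def less_Sup_iff by blast
  then show ?thesis by (intro exI[of _ s]) simp
qed

lemma reach_pos_imp_nonempty:
  assumes "0 < reach Z"
  shows "Z \<noteq> {}"
proof
  assume "Z = {}"
  then have "infdist x Z = 0" for x by (simp add: infdist_def)
  moreover have "ereal 0 < reach Z" using assms by (simp add: zero_ereal_def)
  from reachD[OF this] obtain s where "0 < s"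
    "\<forall>x. infdist x Z < s \<longrightarrow> (\<exists>!z. z \<in> Z \<and> infdist x Z = dist x z)" by blast
  ultimately have "\<exists>z. z \<in> Z" by metis
  with \<open>Z = {}\<close> show False by simp
qed

lemma local_signed_dist_exists:
  fixes Z :: "'a::euclidean_space set"
  assumes Z: "compact_C1_hypersurface Z" "Z \<noteq> {}" and r: "0 < r" "ereal r < reach Z"
  shows "\<forall>x. infdist x Z \<le> r \<longrightarrow> (\<exists>U \<tau> N. local_signed_dist Z U \<tau> N \<and> x \<in> U)"
proof (intro allI impI)
  fix x assume x: "infdist x Z \<le> r"
  have comp: "compact Z" and hyp: "C1_hypersurface Z" using Z(1) by (auto simp: compact_C1_hypersurface_def)
  \<comment> \<open>The strict inequality leaves room for \<open>s\<close> beyond \<open>r\<close>,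
    so that points at distance exactly \<open>r\<close> lie in the open set where the projection is
    continuous.\<close>
  obtain s where s: "r < s" "0 < s"
    and unique: "\<forall>x. infdist x Z < s \<longrightarrow> (\<exists>!z. z \<in> Z \<and> infdist x Z = dist x z)"
    using reachD[OF r(2)] by blast
  have cont: "continuous_on {x. infdist x Z < s} (closest_point Z)"
    by (rule continuous_on_closest_point_unique[OF comp Z(2)]) (simp add: unique)
  show "\<exists>U \<tau> N. local_signed_dist Z U \<tau> N \<and> x \<in> U"
  proof (cases "infdist x Z = 0")
    case True
    then have "x \<in> Z" using in_closed_iff_infdist_zero[OF compact_imp_closed[OF comp] Z(2)] by blast
    then show ?thesis using local_signed_dist_at[OF comp hyp _ s(2) cont] by blast
  next
    case False
    then have "x \<in> {x. 0 < infdist x Z \<and> infdist x Z < s}" using infdist_nonneg[of x Z] x s(1) by simp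
    then show ?thesis using local_signed_dist_off[OF comp Z(2) cont] by blast
  qed
qed

text \<open>With \<open>w\<close> the squared slope, the saturation is
  \<open>r / 2 * (1 - w)\<close>, so both bounds become polynomial inequalities in \<open>w\<close>
  between 0 and 1.\<close>

lemma saturation_gradient_bounds:
  assumes r: "0 < r" "r \<le> 1" and d: "0 \<le> d"
  shows "r / 2 \<le> sqrt ((saturation r d)\<^sup>2 + (max 0 (1 - d / r))\<^sup>2)"
    and "sqrt ((saturation r d)\<^sup>2 + (max 0 (1 - d / r))\<^sup>2) \<le> 1"
proof -
  define w where "w = (max 0 (1 - d / r))\<^sup>2"
  have w: "0 \<le> w" "w \<le> 1" using r d by (auto simp: w_def max_def power_le_one)
  have sat: "saturation r d = r / 2 * (1 - w)"
  proof (cases "d \<le> r")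
    case True
    then show ?thesis using r d by (simp add: saturation_eq w_def max_def)
  next
    case False
    then show ?thesis using r by (simp add: saturation_const w_def max_def divide_simps)
  qed
  have r2: "(r / 2)\<^sup>2 \<le> 1 / 4" using r power_mono[of "r / 2" "1 / 2" 2] by (simp add: power2_eq_square)
  have "(a * (1 - w))\<^sup>2 + w - a\<^sup>2 = w * (1 - a\<^sup>2 * (2 - w))" for a
    by (simp add: algebra_simps power2_eq_square)
  then have "(saturation r d)\<^sup>2 + w - (r / 2)\<^sup>2 = w * (1 - (r / 2)\<^sup>2 * (2 - w))"
    unfolding sat .
  \<comment> \<open>Here \<open>r \<le> 1\<close> enters: the subtracted product is at most 1/2, so
    the last factor of the identity is positive.\<close>
  moreover have "(r / 2)\<^sup>2 * (2 - w) \<le> 1 / 4 * 2" using r2 w by (intro mult_mono) auto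
  then have "0 \<le> w * (1 - (r / 2)\<^sup>2 * (2 - w))" using w by (intro mult_nonneg_nonneg) auto
  ultimately have "(r / 2)\<^sup>2 \<le> (saturation r d)\<^sup>2 + w" by linarith
  then show "r / 2 \<le> sqrt ((saturation r d)\<^sup>2 + (max 0 (1 - d / r))\<^sup>2)"
    unfolding w_def by (rule real_le_rsqrt)
  have "(saturation r d)\<^sup>2 = (r / 2)\<^sup>2 * (1 - w)\<^sup>2" by (simp only: sat power_mult_distrib)
  also have "\<dots> \<le> 1 * (1 - w)" using r2 w by (intro mult_mono) (auto simp: power2_eq_square mult_left_le_one_le)
  finally show "sqrt ((saturation r d)\<^sup>2 + (max 0 (1 - d / r))\<^sup>2) \<le> 1"
    by (simp add: w_def[symmetric])
qed

lemma disk_ereal: "disk c (ereal R) = cball c R"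
  by (auto simp: disk_def)

text \<open>A positive \<open>a\<close> keeps the extended denominator away from zero, so numerator
  and denominator may be estimated one after the other; a point of \<open>D\<close> gives
  \<open>0 < b\<close>.\<close>

lemma kappa1_le:
  assumes "D \<noteq> {}" "0 < a"
    and "\<And>x. x \<in> D \<Longrightarrow> a \<le> sqrt (\<bar>f x\<bar>\<^sup>2 + (norm (gradient f x))\<^sup>2)"
    and "\<And>x. x \<in> D \<Longrightarrow> sqrt (\<bar>f x\<bar>\<^sup>2 + (norm (gradient f x))\<^sup>2) \<le> b"
    and "\<And>x. x \<in> frontier D \<Longrightarrow> a \<le> \<bar>f x\<bar>"
  shows "kappa1 f D \<le> ereal (b / a)"
proof -
  obtain x where x: "x \<in> D" using assms(1) by blast
  have b: "0 < b" using assms(2) assms(3,4)[OF x] by linarith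
  have m: "ereal a \<le> min (bdry_min f D) (delta f D)"
    unfolding bdry_min_def delta_def using assms by (auto intro!: INF_greatest)
  have "nu1 f D \<le> ereal b"
    unfolding nu1_def using assms by (auto intro!: SUP_least)
  then have "kappa1 f D \<le> ereal b / min (bdry_min f D) (delta f D)"
    unfolding kappa1_def using m assms(2) by (intro ereal_divide_right_mono) (auto intro: less_le_trans[of _ "ereal a"])
  also have "\<dots> \<le> ereal b / ereal a"
    using m b assms(2) by (intro ereal_divide_left_mono) (auto simp: ereal_zero_less_0_iff intro: less_le_trans[of _ "ereal a"])
  finally show ?thesis using assms(2) by simp
qed

theorem theorem187:
  fixes Z :: "(real ^ 'n) set"
  assumes "compact_C1_hypersurface Z"
    and "reach Z > 0"
  shows "\<exists>f :: real ^ 'n \<Rightarrow> real.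
           C1_on f UNIV \<and> {x. f x = 0} = Z \<and>
           (\<forall>c R. Z \<subseteq> interior (disk c (ereal R - reach Z)) \<longrightarrow>
              kappa1 f (disk c (ereal R)) \<le> 2 * (1 + 1 / reach Z))"
proof -
  have ne: "Z \<noteq> {}" by (rule reach_pos_imp_nonempty[OF assms(2)])
  have comp: "compact Z" using assms(1) by (simp add: compact_C1_hypersurface_def)
  obtain r where r: "0 < r" "r \<le> 1" "ereal r < reach Z"
    and bound: "\<And>\<rho>. reach Z = ereal \<rho> \<Longrightarrow> 2 / r = 2 * (1 + 1 / \<rho>)"
  proof (cases "reach Z")
    case (real \<rho>)
    then have "\<rho> > 0" using assms(2) by simp
    then show ?thesis using real by (intro that[of "\<rho> / (\<rho> + 1)"]) (auto simp: field_simps)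
  next
    case PInf
    then show ?thesis by (intro that[of 1]) simp_all
  next
    case MInf
    then show ?thesis using assms(2) by simp
  qed
  obtain f :: "real ^ 'n \<Rightarrow> real" where f: "C1_on f UNIV"
    "\<forall>x. \<bar>f x\<bar> = saturation r (infdist x Z)"
    "\<forall>x. norm (gradient f x) = max 0 (1 - infdist x Z / r)"
    using saturated_signed_distance[OF comp ne r(1) local_signed_dist_exists[OF assms(1) ne r(1,3)]] by blast
  note f = f(1) f(2)[rule_format] f(3)[rule_format]
  have zero: "f x = 0 \<longleftrightarrow> x \<in> Z" for x
  proof -
    have "f x = 0 \<longleftrightarrow> infdist x Z = 0"
      using f(2)[of x] r(1) saturation_pos[of "infdist x Z" r] saturation_eq[of 0 r] infdist_nonneg[of x Z]
      by (cases "infdist x Z = 0") auto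
    then show ?thesis using in_closed_iff_infdist_zero[OF compact_imp_closed[OF comp] ne] by simp
  qed
  have "kappa1 f (disk c (ereal R)) \<le> 2 * (1 + 1 / reach Z)"
    if sub: "Z \<subseteq> interior (disk c (ereal R - reach Z))" for c R
  proof (cases "reach Z")
    case (real \<rho>)
    have \<rho>: "\<rho> > 0" "r < \<rho>" using assms(2) r(3) real by auto
    have sub': "Z \<subseteq> ball c (R - \<rho>)" using sub by (simp add: real disk_ereal)
    have R: "R > \<rho>"
    proof -
      obtain z where "z \<in> ball c (R - \<rho>)" using ne sub' by blast
      then have "dist c z < R - \<rho>" by simp
      then show ?thesis using zero_le_dist[of c z] by linarith
    qed
    \<comment> \<open>The bounds by 1 and \<open>r / 2\<close> hold on the whole space; the position
      of the disk matters only for the boundary minimum.\<close>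
    have "kappa1 f (cball c R) \<le> ereal (1 / (r / 2))"
    proof (rule kappa1_le)
      show "cball c R \<noteq> {}" using R \<rho> by simp
      show "0 < r / 2" using r by simp
      show "r / 2 \<le> sqrt (\<bar>f x\<bar>\<^sup>2 + (norm (gradient f x))\<^sup>2)"
        "sqrt (\<bar>f x\<bar>\<^sup>2 + (norm (gradient f x))\<^sup>2) \<le> 1" for x
        unfolding f(2,3) by (rule saturation_gradient_bounds[OF r(1,2) infdist_nonneg])+
      \<comment> \<open>A boundary point is more than \<open>\<rho>\<close>, hence more than
        \<open>r\<close>, away from \<open>Z\<close>, so \<open>f\<close> is saturated
        there.\<close>
      fix x assume "x \<in> frontier (cball c R)"
      then have x: "dist c x = R" by (simp add: frontier_cball)
      obtain z where z: "z \<in> Z" "infdist x Z = dist x z"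
        using infdist_attains_inf[OF compact_imp_closed[OF comp] ne] by blast
      have "dist c z < R - \<rho>" using sub' z(1) by auto
      then have "r \<le> infdist x Z" using dist_triangle[of c x z] x z(2) \<rho> by (simp add: dist_commute)
      then show "r / 2 \<le> \<bar>f x\<bar>" using r(1) by (simp add: f(2) saturation_const)
    qed
    also have "1 / (r / 2) = 2 * (1 + 1 / \<rho>)" using bound[OF real] by simp
    finally show ?thesis using \<rho> by (simp add: real disk_ereal one_ereal_def)
  next
    case PInf
    \<comment> \<open>The radius is \<open>- \<infinity>\<close>, so no disk satisfies the
      containment and the claim is vacuous.\<close>
    then have "disk c (ereal R - reach Z) = {}" by (simp add: disk_def)
    then show ?thesis using sub ne by simp
  next
    case MInf
    then show ?thesis using assms(2) by simp
  qed
  moreover have "{x. f x = 0} = Z" using zero by blast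
  ultimately show ?thesis using f(1) by blast
qed

end
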